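(* Let $\mathscr{P}$ be one of the following three properties of coarse spaces: finite weak coarse decomposition complexity, finite coarse decomposition complexity, or straight finite (coarse) decomposition complexity. Let $(X,\mathscr{E})$ be a coarse space with property $\mathscr{P}$ and let $x_0\in X$ be a basepoint. Then the coarse free product $(\ast X,\ast\mathscr{E})$ has property $\mathscr{P}$.
   Context: Coarse spaces. For $E,F\subset X\times X$ put $E\circ F=\{(x,z): \exists y,\ (x,y)\in E,\ (y,z)\in F\}$, $E^{-1}=\{(y,x):(x,y)\in E\}$, and let $\Delta$ be the diagonal. A coarse structure on $X$ is a collection $\mathscr{E}$ of subsets of $X\times X$ (called entourages) containing $\Delta$ and closed under inverses, finite unions, subsets and compositions; $(X,\mathscr{E})$ is then a coarse space. A family $\mathcal{U}$ of subsets of $X$ is $E$-disjoint if $(U\times U')\cap E=\emptyset$ for distinct $U,U'\in\mathcal{U}$, and bounded if $\bigcup_{U\in\mathcal{U}}U\times U\subset K$ for some $K\in\mathscr{E}$. Decomposition complexity. Let $\mathcal{Y},\mathcal{Z}$ be families of subsets of $(X,\mathscr{E})$, $L\in\mathscr{E}$ and $n\ge 1$. $\mathcal{Y}$ is $(L,n)$-decomposable over $\mathcal{Z}$ if every $Y\in\mathcal{Y}$ can be written $Y=Y_1\cup\dots\cup Y_n$ where each $Y_i$ is the union of an $L$-disjoint family of members of $\mathcal{Z}$. - Finite coarse decomposition complexity: let $\mathfrak{D}$ be the smallest class of families of subsets of $X$ that contains all bounded families and contains $\mathcal{Y}$ whenever for every $L\in\mathscr{E}$ there is $\mathcal{Z}\in\mathfrak{D}$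 such that $\mathcal{Y}$ is $(L,2)$-decomposable over $\mathcal{Z}$. $X$ has the property if $\{X\}\in\mathfrak{D}$. - Finite weak coarse decomposition complexity: let $\mathfrak{D}_w$ be the smallest class of families of subsets of $X$ that contains all bounded families and contains $\mathcal{Y}$ whenever there is $n\ge1$ such that for every $L\in\mathscr{E}$ there is $\mathcal{Z}\in\mathfrak{D}_w$ such that $\mathcal{Y}$ is $(L,n)$-decomposable over $\mathcal{Z}$. $X$ has the property if $\{X\}\in\mathfrak{D}_w$. - Straight finite decomposition complexity: for every sequence $L_1\subset L_2\subset\cdots$ of entourages there are $n$ and families $\mathcal{V}_0=\{X\},\mathcal{V}_1,\dots,\mathcal{V}_n$ of subsets of $X$ such that $\mathcal{V}_{i-1}$ is $(L_i,2)$-decomposable over $\mathcal{V}_i$ for $i=1,\dots,n$ and $\mathcal{V}_n$ is bounded. Coarse free product. $\ast X$ is the set of finite words in the alphabet $X\setminus\{x_0\}$, including the empty word $\boldsymbol{\epsilon}$, which is identified with $x_0$. For $E\in\mathscr{E}$ let $E^k$ be the $k$-fold composition ($k\ge1$), $E^0=E\cap\Delta$, and $D_E(x,y)=\min\{k\ge 0:(x,y)\in E^k\}\in\mathbb{Z}_{\ge0}\cup\{+\infty\}$ ($\min\emptyset=+\infty$). For $\mathbf{x}=x_1\cdots x_k\in\ast X$ put $\|\mathbf{x}\|_E=\sum_i D_E(x_0,x_i)$, $\|\mathbf{x}\|^E=\sum_i D_E(x_i,x_0)$, and $\|\boldsymbol{\epsilon}\|_E=\|\boldsymbol{\epsilon}\|^E=0$.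 Distinct words are written uniquely as $\mathbf{x}=\mathbf{a}b\mathbf{c}$, $\mathbf{x}'=\mathbf{a}b'\mathbf{c}'$, where $\mathbf{a}$ is their longest common prefix and $b\ne b'$ are the next letters (if $\mathbf{x}=\mathbf{a}$ then $b=x_0$, $\mathbf{c}=\boldsymbol{\epsilon}$; similarly for $\mathbf{x}'$). Put $D^*_E(\mathbf{x},\mathbf{x})=0$ and $D_E^*(\mathbf{x},\mathbf{x}')=D_E(b,b')+\|\mathbf{c}\|_E+\|\mathbf{c}'\|^E$ for $\mathbf{x}\ne\mathbf{x}'$. Let $\langle E,n\rangle=\{(\mathbf{x},\mathbf{x}'): D_E^*(\mathbf{x},\mathbf{x}')\le n\}$. The coarse structure $\ast\mathscr{E}$ consists of all subsets of the sets $\langle E,n\rangle$, $E\in\mathscr{E}$, $n\in\mathbb{N}$. *)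

theory Defs
  imports Main "HOL-Library.Extended_Nat" "HOL-Library.Sublist"
begin

section \<open>Coarse spaces\<close>

locale coarse_space =
  fixes X :: "'a set" and \<E> :: "('a \<times> 'a) set set"
  assumes entourage_subset: "E \<in> \<E> \<Longrightarrow> E \<subseteq> X \<times> X"
    and diagonal: "Id_on X \<in> \<E>"
    and converse: "E \<in> \<E> \<Longrightarrow> E\<inverse> \<in> \<E>"
    and union: "E \<in> \<E> \<Longrightarrow> F \<in> \<E> \<Longrightarrow> E \<union> F \<in> \<E>"
    and subset: "E \<in> \<E> \<Longrightarrow> F \<subseteq> E \<Longrightarrow> F \<in> \<E>"
    and composition: "E \<in> \<E> \<Longrightarrow> F \<in> \<E> \<Longrightarrow> E O F \<in> \<E>"

definition entourage_disjoint :: "('a \<times> 'a) set \<Rightarrow> 'a set set \<Rightarrow> bool" where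
  "entourage_disjoint E \<U> \<longleftrightarrow> (\<forall>U\<in>\<U>. \<forall>U'\<in>\<U>. U \<noteq> U' \<longrightarrow> (U \<times> U') \<inter> E = {})"

definition bounded_family :: "('a \<times> 'a) set set \<Rightarrow> 'a set set \<Rightarrow> bool" where
  "bounded_family \<E> \<U> \<longleftrightarrow> (\<exists>K\<in>\<E>. (\<Union>U\<in>\<U>. U \<times> U) \<subseteq> K)"


section \<open>Decomposition complexity\<close>

definition decomposable_over ::
    "('a \<times> 'a) set \<Rightarrow> nat \<Rightarrow> 'a set set \<Rightarrow> 'a set set \<Rightarrow> bool" where
  "decomposable_over L n \<Y> \<Z> \<longleftrightarrow>
    (\<forall>Y\<in>\<Y>. \<exists>P :: nat \<Rightarrow> 'a set. Y = (\<Union>i\<in>{1..n}. P i) \<and>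
      (\<forall>i\<in>{1..n}. \<exists>\<W>. \<W> \<subseteq> \<Z> \<and> entourage_disjoint L \<W> \<and> P i = \<Union>\<W>))"

inductive_set fcdc_families :: "'a set \<Rightarrow> ('a \<times> 'a) set set \<Rightarrow> 'a set set set"
  for X :: "'a set" and \<E> :: "('a \<times> 'a) set set" where
  bounded: "\<Y> \<subseteq> Pow X \<Longrightarrow> bounded_family \<E> \<Y> \<Longrightarrow> \<Y> \<in> fcdc_families X \<E>"
| decompose: "\<Y> \<subseteq> Pow X \<Longrightarrow>
    (\<forall>L\<in>\<E>. \<exists>\<Z>. \<Z> \<in> fcdc_families X \<E> \<and> decomposable_over L 2 \<Y> \<Z>) \<Longrightarrow>
    \<Y> \<in> fcdc_families X \<E>"

definition finite_coarse_dc :: "'a set \<Rightarrow> ('a \<times> 'a) set set \<Rightarrow> bool" where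
  "finite_coarse_dc X \<E> \<longleftrightarrow> {X} \<in> fcdc_families X \<E>"

inductive_set fwcdc_families :: "'a set \<Rightarrow> ('a \<times> 'a) set set \<Rightarrow> 'a set set set"
  for X :: "'a set" and \<E> :: "('a \<times> 'a) set set" where
  bounded: "\<Y> \<subseteq> Pow X \<Longrightarrow> bounded_family \<E> \<Y> \<Longrightarrow> \<Y> \<in> fwcdc_families X \<E>"
| decompose: "\<Y> \<subseteq> Pow X \<Longrightarrow> n \<ge> 1 \<Longrightarrow>
    (\<forall>L\<in>\<E>. \<exists>\<Z>. \<Z> \<in> fwcdc_families X \<E> \<and> decomposable_over L n \<Y> \<Z>) \<Longrightarrow>
    \<Y> \<in> fwcdc_families X \<E>"

definition finite_weak_coarse_dc :: "'a set \<Rightarrow> ('a \<times> 'a) set set \<Rightarrow> bool" where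
  "finite_weak_coarse_dc X \<E> \<longleftrightarrow> {X} \<in> fwcdc_families X \<E>"

text \<open>The sequence of entourages is indexed from 1; the value \<open>L 0\<close> is irrelevant.\<close>

definition straight_finite_dc :: "'a set \<Rightarrow> ('a \<times> 'a) set set \<Rightarrow> bool" where
  "straight_finite_dc X \<E> \<longleftrightarrow>
    (\<forall>L :: nat \<Rightarrow> ('a \<times> 'a) set.
      (\<forall>i\<ge>1. L i \<in> \<E> \<and> L i \<subseteq> L (i + 1)) \<longrightarrow>
      (\<exists>(n :: nat) (\<V> :: nat \<Rightarrow> 'a set set).
        \<V> 0 = {X} \<and> (\<forall>i\<le>n. \<V> i \<subseteq> Pow X) \<and>
        (\<forall>i\<in>{1..n}. decomposable_over (L i) 2 (\<V> (i - 1)) (\<V> i)) \<and>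
        bounded_family \<E> (\<V> n)))"


section \<open>The coarse free product\<close>

text \<open>For \<open>k = 0\<close> this is \<open>E \<inter> \<Delta>\<close>, not \<open>\<Delta>\<close>, so it differs from \<^term>\<open>E ^^ 0\<close>.\<close>

definition entourage_power :: "('a \<times> 'a) set \<Rightarrow> nat \<Rightarrow> ('a \<times> 'a) set" where
  "entourage_power E k = (if k = 0 then E \<inter> Id else E ^^ k)"

text \<open>In \<^typ>\<open>enat\<close> the infimum of a nonempty set is its minimum, and the infimum of
  the empty set is \<open>\<infinity>\<close>.\<close>

definition entourage_dist :: "('a \<times> 'a) set \<Rightarrow> 'a \<Rightarrow> 'a \<Rightarrow> enat" where
  "entourage_dist E x y = (INF k\<in>{k. (x, y) \<in> entourage_power E k}. enat k)"

text \<open>The empty word \<open>[]\<close> plays the role of the base point.\<close>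

definition free_words :: "'a set \<Rightarrow> 'a \<Rightarrow> 'a list set" where
  "free_words X x\<^sub>0 = lists (X - {x\<^sub>0})"

definition norm_from :: "'a \<Rightarrow> ('a \<times> 'a) set \<Rightarrow> 'a list \<Rightarrow> enat" where
  "norm_from x\<^sub>0 E w = (\<Sum>x\<leftarrow>w. entourage_dist E x\<^sub>0 x)"

definition norm_to :: "'a \<Rightarrow> ('a \<times> 'a) set \<Rightarrow> 'a list \<Rightarrow> enat" where
  "norm_to x\<^sub>0 E w = (\<Sum>x\<leftarrow>w. entourage_dist E x x\<^sub>0)"

definition first_letter :: "'a \<Rightarrow> 'a list \<Rightarrow> 'a" where
  "first_letter x\<^sub>0 w = (case w of [] \<Rightarrow> x\<^sub>0 | b # _ \<Rightarrow> b)"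

text \<open>Below, \<open>u\<close> and \<open>u'\<close> are the words \<open>bc\<close> and \<open>b'c'\<close> left after removing the longest
  common prefix; if one of them is empty, its first letter is \<open>x\<^sub>0\<close> and, as \<open>tl [] = []\<close>, its
  remainder is empty.\<close>

definition free_dist :: "'a \<Rightarrow> ('a \<times> 'a) set \<Rightarrow> 'a list \<Rightarrow> 'a list \<Rightarrow> enat" where
  "free_dist x\<^sub>0 E w w' =
    (if w = w' then 0
     else let a = longest_common_prefix w w';
              u = drop (length a) w; u' = drop (length a) w'
          in entourage_dist E (first_letter x\<^sub>0 u) (first_letter x\<^sub>0 u')
             + norm_from x\<^sub>0 E (tl u) + norm_to x\<^sub>0 E (tl u'))"

definition free_entourage ::
    "'a set \<Rightarrow> 'a \<Rightarrow> ('a \<times> 'a) set \<Rightarrow> nat \<Rightarrow> ('a list \<times> 'a list) set" where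
  "free_entourage X x\<^sub>0 E n =
    {(w, w'). w \<in> free_words X x\<^sub>0 \<and> w' \<in> free_words X x\<^sub>0 \<and> free_dist x\<^sub>0 E w w' \<le> enat n}"

definition free_coarse_structure ::
    "'a set \<Rightarrow> ('a \<times> 'a) set set \<Rightarrow> 'a \<Rightarrow> ('a list \<times> 'a list) set set" where
  "free_coarse_structure X \<E> x\<^sub>0 = {A. \<exists>E\<in>\<E>. \<exists>n. A \<subseteq> free_entourage X x\<^sub>0 E n}"


subsection \<open>The coarse free product is a coarse space\<close>

lemma entourage_power_mono:
  assumes "E \<subseteq> F" shows "entourage_power E k \<subseteq> entourage_power F k"
proof (cases "k = 0")
  case False
  have "E ^^ k \<subseteq> F ^^ k"
    by (induction k) (use assms in auto)
  then show ?thesis using False by (simp add: entourage_power_def)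
qed (use assms in \<open>auto simp: entourage_power_def\<close>)

lemma entourage_dist_antimono:
  assumes "E \<subseteq> F" shows "entourage_dist F x y \<le> entourage_dist E x y"
  unfolding entourage_dist_def
  by (rule INF_superset_mono) (use entourage_power_mono[OF assms] in auto)

lemma free_dist_antimono:
  assumes "E \<subseteq> F" shows "free_dist x\<^sub>0 F w w' \<le> free_dist x\<^sub>0 E w w'"
  unfolding free_dist_def Let_def norm_from_def norm_to_def
  by (auto intro!: add_mono sum_list_mono entourage_dist_antimono[OF assms])

lemma free_entourage_mono:
  assumes "E \<subseteq> F" "n \<le> m"
  shows "free_entourage X x\<^sub>0 E n \<subseteq> free_entourage X x\<^sub>0 F m"
proof -
  have "free_dist x\<^sub>0 F w w' \<le> enat m" if "free_dist x\<^sub>0 E w w' \<le> enat n" for w w'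
  proof -
    have "free_dist x\<^sub>0 F w w' \<le> free_dist x\<^sub>0 E w w'" by (rule free_dist_antimono[OF assms(1)])
    also note that
    also have "enat n \<le> enat m" using assms(2) by simp
    finally show ?thesis .
  qed
  then show ?thesis by (auto simp: free_entourage_def)
qed

lemma entourage_dist_le_iff:
  assumes "Id_on X \<subseteq> E" "E \<subseteq> X \<times> X" "x \<in> X"
  shows "entourage_dist E x y \<le> enat n \<longleftrightarrow> (\<exists>k\<le>n. (x, y) \<in> E ^^ k)"
proof -
  have pow: "(x, y) \<in> entourage_power E k \<longleftrightarrow> (x, y) \<in> E ^^ k" for k
    using assms by (auto simp: entourage_power_def)
  let ?S = "{k. (x, y) \<in> E ^^ k}"
  show ?thesis
  proof
    assume le: "entourage_dist E x y \<le> enat n"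
    then have "Inf (enat ` ?S) \<le> enat n" by (simp add: entourage_dist_def pow)
    moreover have "?S \<noteq> {}"
    proof
      assume "?S = {}"
      then have "entourage_dist E x y = \<infinity>" by (simp only: entourage_dist_def pow) (simp add: Inf_enat_def)
      then show False using le by simp
    qed
    then obtain k where "enat k \<in> enat ` ?S" by blast
    then have "Inf (enat ` ?S) \<in> enat ` ?S"
      using LeastI[of "\<lambda>e. e \<in> enat ` ?S" "enat k"] unfolding Inf_enat_def by (metis empty_iff)
    ultimately show "\<exists>k\<le>n. (x, y) \<in> E ^^ k" by auto
  next
    assume "\<exists>k\<le>n. (x, y) \<in> E ^^ k"
    then obtain k where "k \<le> n" "(x, y) \<in> E ^^ k" by blast
    then show "entourage_dist E x y \<le> enat n"
      unfolding entourage_dist_def pow by (intro INF_lower2[of k]) auto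
  qed
qed

lemma entourage_dist_triangle:
  assumes E: "Id_on X \<subseteq> E" "E \<subseteq> X \<times> X" and "x \<in> X" "y \<in> X"
  shows "entourage_dist E x z \<le> entourage_dist E x y + entourage_dist E y z"
proof (cases "entourage_dist E x y" "entourage_dist E y z" rule: enat2_cases)
  case (enat_enat a b)
  obtain k l where "k \<le> a" "(x, y) \<in> E ^^ k" "l \<le> b" "(y, z) \<in> E ^^ l"
    using enat_enat entourage_dist_le_iff[OF E \<open>x \<in> X\<close>] entourage_dist_le_iff[OF E \<open>y \<in> X\<close>]
    by (metis order_refl)
  then have "k + l \<le> a + b" "(x, z) \<in> E ^^ (k + l)"
    by (auto simp: relpow_add)
  then show ?thesis
    using entourage_dist_le_iff[OF E \<open>x \<in> X\<close>] enat_enat by (metis plus_enat_simps(1))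
qed auto

lemma converse_relpow:
  fixes E :: "('a \<times> 'a) set"
  shows "(E ^^ k)\<inverse> = (E\<inverse>) ^^ k"
proof (induction k)
  case (Suc k)
  have "(E ^^ Suc k)\<inverse> = E\<inverse> O (E ^^ k)\<inverse>" by (simp add: converse_relcomp)
  also have "\<dots> = (E\<inverse>) ^^ Suc k" by (simp only: Suc.IH relpow.simps relpow_commute)
  finally show ?case .
qed simp

lemma entourage_dist_converse: "entourage_dist (E\<inverse>) x y = entourage_dist E y x"
proof -
  have "(x, y) \<in> entourage_power (E\<inverse>) k \<longleftrightarrow> (y, x) \<in> entourage_power E k" for k
    by (auto simp: entourage_power_def simp flip: converse_relpow)
  then show ?thesis by (simp add: entourage_dist_def)
qed

lemma norm_from_converse: "norm_from x\<^sub>0 (E\<inverse>) w = norm_to x\<^sub>0 E w"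
  by (simp add: norm_from_def norm_to_def entourage_dist_converse)

lemma norm_to_converse: "norm_to x\<^sub>0 (E\<inverse>) w = norm_from x\<^sub>0 E w"
  by (simp add: norm_from_def norm_to_def entourage_dist_converse)

lemma longest_common_prefix_commute: "longest_common_prefix v w = longest_common_prefix w v"
  by (induction v w rule: longest_common_prefix.induct) auto

lemma free_dist_converse: "free_dist x\<^sub>0 (E\<inverse>) w w' = free_dist x\<^sub>0 E w' w"
  by (auto simp: free_dist_def Let_def entourage_dist_converse norm_from_converse norm_to_converse
      longest_common_prefix_commute[of w w'] add_ac)

lemma entourage_dist_refl:
  assumes "Id_on X \<subseteq> E" "x \<in> X" shows "entourage_dist E x x = 0"
proof -
  have "entourage_dist E x x \<le> enat 0"
    unfolding entourage_dist_def
    by (intro INF_lower) (use assms in \<open>auto simp: entourage_power_def\<close>)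
  then show ?thesis by (simp add: zero_enat_def[symmetric])
qed

lemma free_dist_Cons:
  "free_dist x\<^sub>0 E (b # c) (b' # c') =
    (if b = b' then free_dist x\<^sub>0 E c c'
     else entourage_dist E b b' + norm_from x\<^sub>0 E c + norm_to x\<^sub>0 E c')"
  by (simp add: free_dist_def Let_def first_letter_def)

lemma free_dist_Nil_left: "free_dist x\<^sub>0 E [] w = norm_from x\<^sub>0 E w" if "E\<inverse> = E"
  using norm_from_converse[of x\<^sub>0 E] that
  by (cases w) (auto simp: free_dist_def first_letter_def norm_from_def norm_to_def)

lemma free_dist_Nil_right: "free_dist x\<^sub>0 E w [] = norm_from x\<^sub>0 E w" if "E\<inverse> = E"
  using free_dist_converse[of x\<^sub>0 E w "[]"] free_dist_Nil_left[OF that] that by simp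

lemma norm_from_Cons: "norm_from x\<^sub>0 E (b # c) = entourage_dist E x\<^sub>0 b + norm_from x\<^sub>0 E c"
  by (simp add: norm_from_def)

lemma free_dist_le_norms:
  assumes E: "Id_on X \<subseteq> E" "E \<subseteq> X \<times> X" "E\<inverse> = E" and "x\<^sub>0 \<in> X" "set v \<subseteq> X" "set w \<subseteq> X"
  shows "free_dist x\<^sub>0 E v w \<le> norm_from x\<^sub>0 E v + norm_from x\<^sub>0 E w"
  using assms(5,6)
proof (induction v arbitrary: w)
  case (Cons b c)
  show ?case
  proof (cases w)
    case w: (Cons b' c')
    have to: "norm_to x\<^sub>0 E = norm_from x\<^sub>0 E" using norm_from_converse[of x\<^sub>0 E] E(3) by auto
    have "entourage_dist E b b' \<le> entourage_dist E x\<^sub>0 b + entourage_dist E x\<^sub>0 b'"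
      using entourage_dist_triangle[OF E(1,2), of b x\<^sub>0 b'] entourage_dist_converse[of E b x\<^sub>0]
        E(3) assms(4) Cons.prems by simp
    from add_right_mono[OF this, of "norm_from x\<^sub>0 E c + norm_from x\<^sub>0 E c'"]
    have "b \<noteq> b' \<Longrightarrow> ?thesis" by (simp add: w free_dist_Cons norm_from_Cons to add_ac)
    moreover have "b = b' \<Longrightarrow> ?thesis"
    proof -
      assume "b = b'"
      have "norm_from x\<^sub>0 E c + norm_from x\<^sub>0 E c' \<le> norm_from x\<^sub>0 E (b # c) + norm_from x\<^sub>0 E w"
        unfolding w norm_from_Cons by (intro add_mono) (simp_all add: add_increasing)
      then show ?thesis
        using Cons.IH[of c'] Cons.prems w \<open>b = b'\<close> by (auto simp: free_dist_Cons intro: order_trans)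
    qed
    ultimately show ?thesis by blast
  qed (simp add: free_dist_Nil_right E norm_from_def)
qed (simp add: free_dist_Nil_left E norm_from_def)

lemma norm_le_free_dist:
  assumes E: "Id_on X \<subseteq> E" "E \<subseteq> X \<times> X" "E\<inverse> = E" and "x\<^sub>0 \<in> X" "set v \<subseteq> X" "set w \<subseteq> X"
  shows "norm_from x\<^sub>0 E v \<le> norm_from x\<^sub>0 E w + free_dist x\<^sub>0 E w v"
  using assms(5,6)
proof (induction v arbitrary: w)
  case (Cons b c)
  show ?case
  proof (cases w)
    case w: (Cons b' c')
    have to: "norm_to x\<^sub>0 E = norm_from x\<^sub>0 E" using norm_from_converse[of x\<^sub>0 E] E(3) by auto
    show ?thesis
    proof (cases "b = b'")
      case True
      then show ?thesis
        using add_left_mono[OF Cons.IH[of c'], of "entourage_dist E x\<^sub>0 b"] Cons.prems w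
        by (simp add: free_dist_Cons norm_from_Cons add_ac)
    next
      case False
      have "entourage_dist E x\<^sub>0 b \<le> entourage_dist E x\<^sub>0 b' + entourage_dist E b' b"
        using entourage_dist_triangle[OF E(1,2), of x\<^sub>0 b' b] assms(4) Cons.prems w by simp
      from add_right_mono[OF this, of "norm_from x\<^sub>0 E c"]
      have "norm_from x\<^sub>0 E (b # c)
          \<le> entourage_dist E x\<^sub>0 b' + entourage_dist E b' b + norm_from x\<^sub>0 E c"
        by (simp add: norm_from_Cons)
      also have "\<dots> \<le> entourage_dist E x\<^sub>0 b' + entourage_dist E b' b + norm_from x\<^sub>0 E c
          + (norm_from x\<^sub>0 E c' + norm_from x\<^sub>0 E c')"
        by (simp add: add_increasing2)
      also have "\<dots> = norm_from x\<^sub>0 E w + free_dist x\<^sub>0 E w (b # c)"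
        using False by (simp add: w free_dist_Cons norm_from_Cons to add_ac)
      finally show ?thesis .
    qed
  qed (simp add: free_dist_Nil_left E norm_from_def)
qed (simp add: norm_from_def)

lemma free_dist_commute: "free_dist x\<^sub>0 E v w = free_dist x\<^sub>0 E w v" if "E\<inverse> = E"
  using free_dist_converse[of x\<^sub>0 E v w] that by simp

lemma free_dist_triangle:
  assumes E: "Id_on X \<subseteq> E" "E \<subseteq> X \<times> X" "E\<inverse> = E" and "x\<^sub>0 \<in> X"
    and "set u \<subseteq> X" "set v \<subseteq> X" "set w \<subseteq> X"
  shows "free_dist x\<^sub>0 E u w \<le> free_dist x\<^sub>0 E u v + free_dist x\<^sub>0 E v w"
  using assms(5-)
proof (induction u arbitrary: v w)
  case Nil
  then show ?case
    using norm_le_free_dist[OF E assms(4), of w v] by (simp add: free_dist_Nil_left E)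
next
  case (Cons a u')
  have to: "norm_to x\<^sub>0 E = norm_from x\<^sub>0 E" using norm_from_converse[of x\<^sub>0 E] E(3) by auto
  consider (Nil_v) "v = []" | (Nil_w) "w = []"
    | (Cons_Cons) b v' c w' where "v = b # v'" "w = c # w'"
    by (meson neq_Nil_conv)
  then show ?case
  proof cases
    case Nil_v
    then show ?thesis
      using free_dist_le_norms[OF E assms(4), of "a # u'" w] Cons.prems
      by (simp add: free_dist_Nil_left free_dist_Nil_right E)
  next
    case Nil_w
    then show ?thesis
      using norm_le_free_dist[OF E assms(4), of "a # u'" v] Cons.prems
      by (simp add: free_dist_Nil_right E free_dist_commute[of E x\<^sub>0 v] add_ac)
  next
    case Cons_Cons
    note vw = Cons_Cons
    have sets: "set u' \<subseteq> X" "set v' \<subseteq> X" "set w' \<subseteq> X" "a \<in> X" "b \<in> X" "c \<in> X"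
      using Cons.prems vw by auto
    let ?N = "norm_from x\<^sub>0 E" and ?d = "entourage_dist E" and ?D = "free_dist x\<^sub>0 E"
    note simps = vw free_dist_Cons to
    consider "a = b" "b = c" | "a = b" "b \<noteq> c" | "a \<noteq> b" "b = c" | "a = c" "a \<noteq> b"
      | "a \<noteq> b" "b \<noteq> c" "a \<noteq> c" by blast
    then show ?thesis
    proof cases
      case 1
      then show ?thesis using Cons.IH[of v' w'] sets by (simp add: simps)
    next
      case 2
      have "?N u' \<le> ?N v' + ?D u' v'"
        using norm_le_free_dist[OF E assms(4), of u' v'] sets
        by (simp add: free_dist_commute[of E x\<^sub>0 v'] E)
      from add_right_mono[OF this, of "?d b c + ?N w'"]
      show ?thesis using 2 by (simp add: simps add_ac)
    next
      case 3
      have "?N w' \<le> ?N v' + ?D v' w'"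
        using norm_le_free_dist[OF E assms(4), of w' v'] sets by simp
      from add_right_mono[OF this, of "?d a b + ?N u'"]
      show ?thesis using 3 by (simp add: simps add_ac)
    next
      case 4
      have "?D u' w' \<le> ?N u' + ?N w'"
        using free_dist_le_norms[OF E assms(4)] sets by simp
      also have "\<dots> \<le> ?N u' + ?N w' + (?d a b + ?d b c + ?N v' + ?N v')"
        by (simp add: add_increasing2)
      finally show ?thesis using 4 by (simp add: simps add_ac)
    next
      case 5
      have "?d a c \<le> ?d a b + ?d b c"
        using entourage_dist_triangle[OF E(1,2)] sets by simp
      from add_right_mono[OF this, of "?N u' + ?N w'"]
      have "?d a c + (?N u' + ?N w') \<le> ?d a b + ?d b c + (?N u' + ?N w')" .
      also have "\<dots> \<le> ?d a b + ?d b c + (?N u' + ?N w') + (?N v' + ?N v')"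
        by (simp add: add_increasing2)
      finally show ?thesis using 5 by (simp add: simps add_ac)
    qed
  qed
qed

lemma (in coarse_space) free_product_coarse_space:
  assumes "x\<^sub>0 \<in> X"
  shows "coarse_space (free_words X x\<^sub>0) (free_coarse_structure X \<E> x\<^sub>0)"
proof
  fix A assume "A \<in> free_coarse_structure X \<E> x\<^sub>0"
  then obtain E n where A: "E \<in> \<E>" "A \<subseteq> free_entourage X x\<^sub>0 E n"
    by (auto simp: free_coarse_structure_def)
  show "A \<subseteq> free_words X x\<^sub>0 \<times> free_words X x\<^sub>0"
    using A by (auto simp: free_entourage_def)
  have "A\<inverse> \<subseteq> free_entourage X x\<^sub>0 (E\<inverse>) n"
    using A(2) by (auto simp: free_entourage_def free_dist_converse)
  then show "A\<inverse> \<in> free_coarse_structure X \<E> x\<^sub>0"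
    using converse[OF A(1)] by (auto simp: free_coarse_structure_def)
  {
    fix B assume "B \<subseteq> A"
    then show "B \<in> free_coarse_structure X \<E> x\<^sub>0"
      using A by (auto simp: free_coarse_structure_def)
  }
  {
    fix B assume "B \<in> free_coarse_structure X \<E> x\<^sub>0"
    then obtain F m where B: "F \<in> \<E>" "B \<subseteq> free_entourage X x\<^sub>0 F m"
      by (auto simp: free_coarse_structure_def)
    define H where "H = E \<union> F \<union> (E \<union> F)\<inverse> \<union> Id_on X"
    have H: "H \<in> \<E>" unfolding H_def by (intro union converse diagonal A B)
    have HX: "Id_on X \<subseteq> H" "H \<subseteq> X \<times> X" "H\<inverse> = H"
      using entourage_subset[OF H] by (auto simp: H_def)
    have "A \<subseteq> free_entourage X x\<^sub>0 H (max n m)" "B \<subseteq> free_entourage X x\<^sub>0 H (max n m)"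
      using A(2) B(2) free_entourage_mono[of E H n "max n m" X x\<^sub>0]
        free_entourage_mono[of F H m "max n m" X x\<^sub>0] by (auto simp: H_def)
    then show "A \<union> B \<in> free_coarse_structure X \<E> x\<^sub>0"
      using H unfolding free_coarse_structure_def by blast
    have AB: "A \<subseteq> free_entourage X x\<^sub>0 H n" "B \<subseteq> free_entourage X x\<^sub>0 H m"
      using A(2) B(2) free_entourage_mono[of E H n n X x\<^sub>0]
        free_entourage_mono[of F H m m X x\<^sub>0] by (auto simp: H_def)
    have "A O B \<subseteq> free_entourage X x\<^sub>0 H (n + m)"
    proof
      fix p assume "p \<in> A O B"
      then obtain u v w where p: "p = (u, w)" "(u, v) \<in> A" "(v, w) \<in> B" by auto
      then have *: "free_dist x\<^sub>0 H u v \<le> enat n" "free_dist x\<^sub>0 H v w \<le> enat m"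
        "u \<in> free_words X x\<^sub>0" "v \<in> free_words X x\<^sub>0" "w \<in> free_words X x\<^sub>0"
        using AB by (auto simp: free_entourage_def)
      have "free_dist x\<^sub>0 H u w \<le> free_dist x\<^sub>0 H u v + free_dist x\<^sub>0 H v w"
        by (rule free_dist_triangle[OF HX assms]) (use *(3-) in \<open>auto simp: free_words_def\<close>)
      also have "\<dots> \<le> enat n + enat m" using * by (intro add_mono)
      finally show "p \<in> free_entourage X x\<^sub>0 H (n + m)"
        using * p by (simp add: free_entourage_def)
    qed
    then show "A O B \<in> free_coarse_structure X \<E> x\<^sub>0"
      using H unfolding free_coarse_structure_def by blast
  }
next
  have "Id_on (free_words X x\<^sub>0) \<subseteq> free_entourage X x\<^sub>0 (Id_on X) 0"
    by (auto simp: free_entourage_def free_dist_def)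
  then show "Id_on (free_words X x\<^sub>0) \<in> free_coarse_structure X \<E> x\<^sub>0"
    using diagonal by (auto simp: free_coarse_structure_def)
qed

end

theory Submission
  imports Defs
begin

text \<open>Left concatenation \<open>v \<mapsto> p v\<close> preserves \<open>D\<^sup>*\<close>, and close words agree up to a bounded tail.
  Cutting words according to length into annuli, and each annulus according to a slightly shorter
  prefix, decomposes \<open>*X\<close> over the translates \<open>p W\<^sub>m\<close>, where \<open>W\<^sub>m\<close> are the words of length at most
  \<open>m\<close>. These are treated by induction on \<open>m\<close>: the first letter after \<open>p\<close> is a coarse map
  \<open>p W\<^bsub>m+1\<^esub> \<rightarrow> X\<close>, along which the decompositions of \<open>X\<close> are pulled back; over a bounded
  set \<open>B\<close>, the words \<open>p b c\<close> with \<open>\<parallel>c\<parallel>\<close> small form a bounded set, while those with \<open>\<parallel>c\<parallel>\<close> large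
  are separated by the letter \<open>b\<close> and lie in the translates \<open>p b W\<^sub>m\<close>.\<close>

section \<open>Decomposability\<close>

lemma entourage_disjoint_antimono:
  "L' \<subseteq> L \<Longrightarrow> entourage_disjoint L \<W> \<Longrightarrow> entourage_disjoint L' \<W>"
  unfolding entourage_disjoint_def by blast

lemma decomposable_over_antimono:
  assumes "L' \<subseteq> L" "decomposable_over L n \<Y> \<Z>"
  shows "decomposable_over L' n \<Y> \<Z>"
  using assms(2) entourage_disjoint_antimono[OF assms(1)]
  unfolding decomposable_over_def by meson

lemma decomposable_over_twoI:
  assumes "\<And>Y. Y \<in> \<Y> \<Longrightarrow> \<exists>\<W> \<W>'. \<W> \<subseteq> \<Z> \<and> \<W>' \<subseteq> \<Z> \<and> entourage_disjoint L \<W> \<and>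
    entourage_disjoint L \<W>' \<and> Y = \<Union>\<W> \<union> \<Union>\<W>'"
  shows "decomposable_over L 2 \<Y> \<Z>"
  unfolding decomposable_over_def
proof
  fix Y assume "Y \<in> \<Y>"
  then obtain \<W> \<W>' where W: "\<W> \<subseteq> \<Z>" "\<W>' \<subseteq> \<Z>" "entourage_disjoint L \<W>"
    "entourage_disjoint L \<W>'" "Y = \<Union>\<W> \<union> \<Union>\<W>'"
    using assms by blast
  have two: "{1..2} = {1, 2 :: nat}" by auto
  show "\<exists>P. Y = (\<Union>i\<in>{1..2}. P i) \<and>
      (\<forall>i\<in>{1..2::nat}. \<exists>\<W>\<subseteq>\<Z>. entourage_disjoint L \<W> \<and> P i = \<Union>\<W>)"
    unfolding two using W by (intro exI[of _ "\<lambda>i. if i = 1 then \<Union>\<W> else \<Union>\<W>'"]) auto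
qed

text \<open>A set from \<open>\<B>\<close> is decomposed as \<open>n\<close> copies of itself, each
  a one-member family and hence vacuously disjoint; \<open>1 \<le> n\<close> keeps the union from
  being empty.\<close>

lemma decomposable_over_Un:
  assumes "decomposable_over L n \<Y> \<Z>" "1 \<le> n"
  shows "decomposable_over L n (\<Y> \<union> \<B>) (\<Z> \<union> \<B>)"
  unfolding decomposable_over_def
proof
  fix Y assume "Y \<in> \<Y> \<union> \<B>"
  then consider "Y \<in> \<Y>" | "Y \<in> \<B>" by blast
  then show "\<exists>P. Y = (\<Union>i\<in>{1..n}. P i) \<and>
      (\<forall>i\<in>{1..n}. \<exists>\<W>\<subseteq>\<Z> \<union> \<B>. entourage_disjoint L \<W> \<and> P i = \<Union>\<W>)"
  proof cases
    case 1
    obtain P where P: "Y = (\<Union>i\<in>{1..n}. P i)"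
      "\<forall>i\<in>{1..n}. \<exists>\<W>\<subseteq>\<Z>. entourage_disjoint L \<W> \<and> P i = \<Union>\<W>"
      using assms(1)[unfolded decomposable_over_def, rule_format, OF 1] by auto
    then show ?thesis by (intro exI[of _ P]) (meson le_supI1)
  next
    case 2
    show ?thesis
    proof (intro exI[of _ "\<lambda>_. Y"] conjI ballI)
      show "Y = (\<Union>i\<in>{1..n}. Y)" using assms(2) by auto
      show "\<exists>\<W>\<subseteq>\<Z> \<union> \<B>. entourage_disjoint L \<W> \<and> Y = \<Union>\<W>"
        using 2 by (intro exI[of _ "{Y}"]) (auto simp: entourage_disjoint_def)
    qed
  qed
qed

text \<open>A common generalization of the three properties: \<open>nxt s\<close> lists the scales that may be played
  in state \<open>s\<close>, together with the resulting states. If every scale may be played in the single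
  state, one obtains (weak) finite decomposition complexity; if the state is a sequence of
  scales of which the head has to be played, one obtains straight finite decomposition
  complexity.\<close>

inductive decomposition_game ::
    "'a set \<Rightarrow> ('a \<times> 'a) set set \<Rightarrow> ('k \<Rightarrow> ('a \<times> 'a) set) \<Rightarrow> nat set \<Rightarrow>
     ('s \<Rightarrow> ('k \<times> 's) set) \<Rightarrow> 's \<Rightarrow> 'a set set \<Rightarrow> bool"
  for X \<E> ent N nxt where
  bounded: "\<Y> \<subseteq> Pow X \<Longrightarrow> bounded_family \<E> \<Y> \<Longrightarrow> decomposition_game X \<E> ent N nxt s \<Y>"
| decompose: "\<Y> \<subseteq> Pow X \<Longrightarrow> n \<in> N \<Longrightarrow>
    (\<forall>k t. (k, t) \<in> nxt s \<longrightarrow>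
      (\<exists>\<Z>. decomposition_game X \<E> ent N nxt t \<Z> \<and> decomposable_over (ent k) n \<Y> \<Z>)) \<Longrightarrow>
    decomposition_game X \<E> ent N nxt s \<Y>"

lemma (in coarse_space) bounded_family_Un:
  assumes "bounded_family \<E> \<Y>" "bounded_family \<E> \<B>"
  shows "bounded_family \<E> (\<Y> \<union> \<B>)"
proof -
  obtain K K' where "K \<in> \<E>" "K' \<in> \<E>" "(\<Union>U\<in>\<Y>. U \<times> U) \<subseteq> K" "(\<Union>U\<in>\<B>. U \<times> U) \<subseteq> K'"
    using assms unfolding bounded_family_def by blast
  then show ?thesis
    unfolding bounded_family_def by (intro bexI[of _ "K \<union> K'"] union) (simp_all, blast)
qed

text \<open>Pieces that are already bounded can be carried unchanged through the rest of the game.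
  This absorbs the bounded leftovers that arise when a cylinder over a bounded set is split.\<close>

lemma (in coarse_space) decomposition_game_Un_bounded:
  assumes "decomposition_game X \<E> ent N nxt s \<Y>" "\<forall>n\<in>N. 1 \<le> n"
    and "bounded_family \<E> \<B>" "\<B> \<subseteq> Pow X"
  shows "decomposition_game X \<E> ent N nxt s (\<Y> \<union> \<B>)"
  using assms(1)
proof (induction rule: decomposition_game.induct)
  case (bounded \<Y> s)
  have "\<Y> \<union> \<B> \<subseteq> Pow X" using bounded(1) assms(4) by simp
  then show ?case by (rule decomposition_game.bounded[OF _ bounded_family_Un[OF bounded(2) assms(3)]])
next
  case (decompose \<Y> n s)
  have "\<Y> \<union> \<B> \<subseteq> Pow X" using decompose.hyps assms by simp
  then show ?case
  proof (rule decomposition_game.decompose[OF _ \<open>n \<in> N\<close>], intro allI impI)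
    fix k t assume "(k, t) \<in> nxt s"
    then obtain \<Z> where "decomposition_game X \<E> ent N nxt t (\<Z> \<union> \<B>)"
      "decomposable_over (ent k) n \<Y> \<Z>"
      using decompose.IH by blast
    then show "\<exists>\<Z>. decomposition_game X \<E> ent N nxt t \<Z> \<and>
        decomposable_over (ent k) n (\<Y> \<union> \<B>) \<Z>"
      using decomposable_over_Un[of "ent k" n \<Y> \<Z> \<B>] assms(2) \<open>n \<in> N\<close> by blast
  qed
qed


section \<open>Distances between words\<close>

text \<open>\<open>entourage_power E 0\<close> lies in the diagonal, so it never relates distinct
  points.\<close>

lemma one_le_entourage_dist: "x \<noteq> y \<Longrightarrow> 1 \<le> entourage_dist E x y"
  unfolding entourage_dist_def
  by (rule INF_greatest) (auto simp: entourage_power_def one_enat_def split: if_splits)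

lemma length_le_norm_from: "x\<^sub>0 \<notin> set w \<Longrightarrow> enat (length w) \<le> norm_from x\<^sub>0 E w"
proof (induction w)
  case (Cons x w)
  then have "1 + enat (length w) \<le> entourage_dist E x\<^sub>0 x + norm_from x\<^sub>0 E w"
    by (intro add_mono one_le_entourage_dist) auto
  then show ?case by (simp add: norm_from_Cons one_enat_def)
qed (simp add: zero_enat_def[symmetric])

lemma norm_from_antimono: "E \<subseteq> F \<Longrightarrow> norm_from x\<^sub>0 F w \<le> norm_from x\<^sub>0 E w"
  unfolding norm_from_def by (intro sum_list_mono entourage_dist_antimono)

lemma norm_to_eq_norm_from: "E\<inverse> = E \<Longrightarrow> norm_to x\<^sub>0 E w = norm_from x\<^sub>0 E w"
  using norm_from_converse[of x\<^sub>0 E w] by simp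

lemma free_dist_append: "free_dist x\<^sub>0 E (p @ v) (p @ w) = free_dist x\<^sub>0 E v w"
  by (induction p) (auto simp: free_dist_Cons)

text \<open>The longest common prefix is empty here. The formula also covers an empty word, whose
  first letter is \<open>x\<^sub>0\<close> and whose tail is empty.\<close>

lemma free_dist_first_letter:
  assumes "first_letter x\<^sub>0 v \<noteq> first_letter x\<^sub>0 w"
  shows "free_dist x\<^sub>0 E v w = entourage_dist E (first_letter x\<^sub>0 v) (first_letter x\<^sub>0 w)
    + norm_from x\<^sub>0 E (tl v) + norm_to x\<^sub>0 E (tl w)"
  using assms by (cases v; cases w) (auto simp: free_dist_def first_letter_def)

text \<open>Past the longest common prefix each word has one letter and a remainder of norm at most
  \<open>n\<close>, hence of length at most \<open>n\<close>, since each letter contributes at least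
  1. So all but the last \<open>n + 1\<close> letters are shared.\<close>

lemma free_dist_common_prefix:
  assumes "E\<inverse> = E" "x\<^sub>0 \<notin> set v" "x\<^sub>0 \<notin> set w" "free_dist x\<^sub>0 E v w \<le> enat n"
  shows "length v \<le> length w + Suc n \<and> length w \<le> length v + Suc n \<and>
    (\<forall>r. r + Suc n \<le> length v \<longrightarrow> r + Suc n \<le> length w \<longrightarrow> take r v = take r w)"
  using assms(2-)
proof (induction v arbitrary: w)
  case Nil
  then have "enat (length w) \<le> enat n"
    using length_le_norm_from[of x\<^sub>0 w E] free_dist_Nil_left[OF assms(1), of x\<^sub>0 w] order_trans by metis
  then show ?case by auto
next
  case (Cons b c)
  show ?case
  proof (cases w)
    case Nil
    then have "enat (length (b # c)) \<le> enat n"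
      using length_le_norm_from[of x\<^sub>0 "b # c" E] free_dist_Nil_right[OF assms(1), of x\<^sub>0 "b # c"]
        Cons.prems order_trans by metis
    then show ?thesis using Nil by auto
  next
    case w: (Cons b' c')
    show ?thesis
    proof (cases "b = b'")
      case True
      then have IH: "length c \<le> length c' + Suc n \<and> length c' \<le> length c + Suc n \<and>
          (\<forall>r. r + Suc n \<le> length c \<longrightarrow> r + Suc n \<le> length c' \<longrightarrow> take r c = take r c')"
        using Cons w by (intro Cons.IH) (auto simp: free_dist_Cons)
      have "take r (b # c) = take r w"
        if "r + Suc n \<le> length (b # c)" "r + Suc n \<le> length w" for r
        using IH that True by (cases r) (auto simp: w)
      then show ?thesis using IH by (auto simp: w)
    next
      case False
      then have "entourage_dist E b b' + norm_from x\<^sub>0 E c + norm_from x\<^sub>0 E c' \<le> enat n"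
        using Cons.prems w by (simp add: free_dist_Cons norm_to_eq_norm_from[OF assms(1)])
      then have "norm_from x\<^sub>0 E c \<le> enat n" "norm_from x\<^sub>0 E c' \<le> enat n"
        by (meson add_increasing add_increasing2 order_trans order_refl zero_le)+
      then have "enat (length c) \<le> enat n" "enat (length c') \<le> enat n"
        using order_trans[OF length_le_norm_from[of x\<^sub>0 c E], of "enat n"]
          order_trans[OF length_le_norm_from[of x\<^sub>0 c' E], of "enat n"] Cons.prems w by auto
      then have "length c \<le> n" "length c' \<le> n" by simp_all
      \<comment> \<open>Here \<open>w\<close> has at most \<open>n + 1\<close> letters, so only
        \<open>r = 0\<close> is possible.\<close>
      moreover from this have "take r (b # c) = take r w" if "r + Suc n \<le> length w" for r
        using that by (cases r) (auto simp: w)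
      ultimately show ?thesis by (simp add: w)
    qed
  qed
qed


section \<open>Pulling decompositions back along the first letter\<close>

locale pointed_coarse_space = coarse_space X \<E>
  for X :: "'a set" and \<E> :: "('a \<times> 'a) set set" +
  fixes x\<^sub>0 :: 'a
  assumes basepoint: "x\<^sub>0 \<in> X"
begin

abbreviation "W \<equiv> free_words X x\<^sub>0"
abbreviation "\<F> \<equiv> free_coarse_structure X \<E> x\<^sub>0"

sublocale free: coarse_space W \<F>
  by (rule free_product_coarse_space[OF basepoint])

text \<open>One pair \<open>(E, n)\<close> yields an entourage on \<open>X\<close> and one on words,
  so the same moves can be played in both spaces. Reflexivity gives the triangle inequality, and
  symmetry identifies \<open>norm_from\<close> with \<open>norm_to\<close>.\<close>

definition scales :: "(('a \<times> 'a) set \<times> nat) set" where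
  "scales = {(E, n). E \<in> \<E> \<and> Id_on X \<subseteq> E \<and> E\<inverse> = E}"

definition base_entourage :: "('a \<times> 'a) set \<times> nat \<Rightarrow> ('a \<times> 'a) set" where
  "base_entourage k = {(x, y) \<in> X \<times> X. entourage_dist (fst k) x y \<le> enat (snd k)}"

definition word_entourage :: "('a \<times> 'a) set \<times> nat \<Rightarrow> ('a list \<times> 'a list) set" where
  "word_entourage k = free_entourage X x\<^sub>0 (fst k) (snd k)"

text \<open>The preimage of \<open>Y\<close> under the first letter after \<open>p\<close>. For
  \<open>Y = X\<close> it is the whole translate of the words of length at most \<open>m\<close>;
  the word \<open>p\<close> itself belongs to it exactly if
  \<open>x\<^sub>0 \<in> Y\<close>.\<close>

definition cylinder :: "nat \<Rightarrow> 'a list \<Rightarrow> 'a set \<Rightarrow> 'a list set" where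
  "cylinder m p Y = {p @ v |v. v \<in> W \<and> length v \<le> m \<and> first_letter x\<^sub>0 v \<in> Y}"

text \<open>Closing under subsets allows pieces of a decomposition to be intersected with a given set.\<close>

definition cylinders :: "nat \<Rightarrow> 'a set set \<Rightarrow> 'a list set set" where
  "cylinders m \<Y> = {S. \<exists>p\<in>W. \<exists>Y\<in>\<Y>. S \<subseteq> cylinder m p Y}"

lemma entourage_symmetric_hull:
  assumes "E \<in> \<E>"
  obtains H where "H \<in> \<E>" "E \<subseteq> H" "Id_on X \<subseteq> H" "H\<inverse> = H"
proof
  show "E \<union> E\<inverse> \<union> Id_on X \<in> \<E>" by (intro union converse diagonal assms)
qed auto

lemma base_entourage_in:
  assumes "k \<in> scales" shows "base_entourage k \<in> \<E>"
proof -
  obtain E n where k: "k = (E, n)" "E \<in> \<E>" "Id_on X \<subseteq> E" using assms by (auto simp: scales_def)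
  \<comment> \<open>\<open>E ^^ 0\<close> is the identity on the whole type, hence the intersection
    with \<open>X \<times> X\<close>.\<close>
  have pow: "\<exists>F\<in>\<E>. (E ^^ j) \<inter> X \<times> X \<subseteq> F" for j
  proof (induction j)
    case 0
    show ?case using diagonal by (intro bexI[of _ "Id_on X"]) auto
  next
    case (Suc j)
    then obtain F where "F \<in> \<E>" "(E ^^ j) \<inter> X \<times> X \<subseteq> F" by blast
    then show ?case
      using composition[of F E] k(2) entourage_subset[OF k(2)]
      by (intro bexI[of _ "F O E"]) auto
  qed
  have "\<exists>F\<in>\<E>. (\<Union>j\<le>n. E ^^ j) \<inter> X \<times> X \<subseteq> F" for n
  proof (induction n)
    case (Suc n)
    then obtain F F' where "F \<in> \<E>" "(\<Union>j\<le>n. E ^^ j) \<inter> X \<times> X \<subseteq> F"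
      "F' \<in> \<E>" "(E ^^ Suc n) \<inter> X \<times> X \<subseteq> F'"
      using pow[of "Suc n"] by blast
    then show ?case
      by (intro bexI[of _ "F \<union> F'"] union) (auto simp: atMost_Suc simp del: relpow.simps)
  qed (use pow[of 0] in simp)
  then obtain F where F: "F \<in> \<E>" "(\<Union>j\<le>n. E ^^ j) \<inter> X \<times> X \<subseteq> F" by blast
  have "base_entourage k \<subseteq> F"
    using F(2) entourage_dist_le_iff[OF k(3) entourage_subset[OF k(2)], of _ _ n]
    by (force simp: base_entourage_def k(1))
  then show ?thesis using F(1) subset by blast
qed

text \<open>Enlarging \<open>E\<close> only decreases the distance of words, so passing to a
  reflexive symmetric hull enlarges the entourage.\<close>

lemma free_entourage_cofinal:
  assumes "A \<in> \<F>" shows "\<exists>k\<in>scales. A \<subseteq> word_entourage k"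
proof -
  obtain E n where E: "E \<in> \<E>" "A \<subseteq> free_entourage X x\<^sub>0 E n"
    using assms by (auto simp: free_coarse_structure_def)
  obtain H where H: "H \<in> \<E>" "E \<subseteq> H" "Id_on X \<subseteq> H" "H\<inverse> = H"
    using entourage_symmetric_hull[OF E(1)] .
  show ?thesis
    using H E(2) free_entourage_mono[OF H(2) order_refl, of X x\<^sub>0 n]
    by (intro bexI[of _ "(H, n)"]) (auto simp: scales_def word_entourage_def)
qed

lemma first_letter_in: "v \<in> W \<Longrightarrow> first_letter x\<^sub>0 v \<in> X"
  using basepoint by (cases v) (auto simp: first_letter_def free_words_def)

lemma free_words_append: "p \<in> W \<Longrightarrow> v \<in> W \<Longrightarrow> p @ v \<in> W"
  by (auto simp: free_words_def)

lemma cylinder_UN: "cylinder m p (\<Union>i\<in>I. Y i) = (\<Union>i\<in>I. cylinder m p (Y i))"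
  unfolding cylinder_def by blast

lemma cylinders_subset_Pow: "cylinders m \<Y> \<subseteq> Pow W"
  by (auto simp: cylinders_def cylinder_def free_words_append)

text \<open>Each of these sets is contained in a singleton \<open>{p}\<close>. This starts the
  induction on word length.\<close>

lemma bounded_cylinders_zero: "bounded_family \<F> (cylinders 0 \<Y>)"
  unfolding bounded_family_def
  by (rule bexI[OF _ free.diagonal]) (auto simp: cylinders_def cylinder_def)

text \<open>Different first letters contribute at most 1 and the tails at most \<open>n\<close>
  each. Equal first letters cancel, and the tails are then compared through the empty word.\<close>

lemma free_dist_le_first_letter:
  assumes E: "Id_on X \<subseteq> E" "E \<subseteq> X \<times> X" "E\<inverse> = E" and vw: "v \<in> W" "w \<in> W"
    and letters: "(first_letter x\<^sub>0 v, first_letter x\<^sub>0 w) \<in> E"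
    and norms: "norm_from x\<^sub>0 E (tl v) \<le> enat n" "norm_from x\<^sub>0 E (tl w) \<le> enat n"
  shows "free_dist x\<^sub>0 E v w \<le> enat (1 + 2 * n)"
proof (cases "first_letter x\<^sub>0 v = first_letter x\<^sub>0 w")
  case False
  have "entourage_dist E (first_letter x\<^sub>0 v) (first_letter x\<^sub>0 w) \<le> enat 1"
    using entourage_dist_le_iff[OF E(1,2) first_letter_in[OF vw(1)]] letters
    by (metis order_refl relpow_1)
  from add_mono[OF add_mono[OF this norms(1)] norms(2)]
  show ?thesis
    unfolding free_dist_first_letter[OF False] norm_to_eq_norm_from[OF E(3)] by (simp add: mult_2)
next
  case True
  have "free_dist x\<^sub>0 E v w = free_dist x\<^sub>0 E (tl v) (tl w)"
    \<comment> \<open>As \<open>x\<^sub>0\<close> is not a letter of a word in \<open>W\<close>,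
      either both words are empty or both start with the same letter.\<close>
    using True vw by (cases v; cases w) (auto simp: first_letter_def free_dist_Cons free_words_def)
  also have "\<dots> \<le> norm_from x\<^sub>0 E (tl v) + norm_from x\<^sub>0 E (tl w)"
  proof (rule free_dist_le_norms[OF E basepoint])
    show "set (tl v) \<subseteq> X" using vw(1) by (cases v) (auto simp: free_words_def)
    show "set (tl w) \<subseteq> X" using vw(2) by (cases w) (auto simp: free_words_def)
  qed
  also have "\<dots> \<le> enat n + enat n" by (intro add_mono norms)
  also have "\<dots> \<le> enat (1 + 2 * n)" by simp
  finally show ?thesis .
qed

text \<open>The letter after \<open>p\<close> does not increase distances at a scale
  \<open>(E, l)\<close>: \<open>D\<^sup>*\<close> dominates the distance of distinct first letters,
  and equal letters have distance 0. So preimages of disjoint sets are disjoint at the same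
  scale.\<close>

lemma decomposable_over_cylinders:
  assumes k: "k \<in> scales" and dec: "decomposable_over (base_entourage k) n \<Y> \<Z>"
  shows "decomposable_over (word_entourage k) n (cylinders m \<Y>) (cylinders m \<Z>)"
  unfolding decomposable_over_def
proof
  obtain E l where kE: "k = (E, l)" "E \<in> \<E>" "Id_on X \<subseteq> E" using k by (auto simp: scales_def)
  fix S assume "S \<in> cylinders m \<Y>"
  then obtain p Y where S: "p \<in> W" "Y \<in> \<Y>" "S \<subseteq> cylinder m p Y" by (auto simp: cylinders_def)
  obtain P where P: "Y = (\<Union>i\<in>{1..n}. P i)"
    "\<forall>i\<in>{1..n}. \<exists>\<W>\<subseteq>\<Z>. entourage_disjoint (base_entourage k) \<W> \<and> P i = \<Union>\<W>"
    using dec[unfolded decomposable_over_def, rule_format, OF S(2)] by auto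
  show "\<exists>P. S = (\<Union>i\<in>{1..n}. P i) \<and> (\<forall>i\<in>{1..n}. \<exists>\<W>\<subseteq>cylinders m \<Z>.
      entourage_disjoint (word_entourage k) \<W> \<and> P i = \<Union>\<W>)"
  proof (intro exI[of _ "\<lambda>i. S \<inter> cylinder m p (P i)"] conjI ballI)
    show "S = (\<Union>i\<in>{1..n}. S \<inter> cylinder m p (P i))"
      using S(3) cylinder_UN[of m p P "{1..n}"] unfolding P(1) by auto
    fix i assume "i \<in> {1..n}"
    then obtain \<W> where W: "\<W> \<subseteq> \<Z>" "entourage_disjoint (base_entourage k) \<W>" "P i = \<Union>\<W>"
      using P(2)[rule_format, of i] by auto
    show "\<exists>\<W>\<subseteq>cylinders m \<Z>. entourage_disjoint (word_entourage k) \<W> \<and>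
        S \<inter> cylinder m p (P i) = \<Union>\<W>"
    proof (intro exI[of _ "(\<lambda>U. S \<inter> cylinder m p U) ` \<W>"] conjI)
      show "(\<lambda>U. S \<inter> cylinder m p U) ` \<W> \<subseteq> cylinders m \<Z>"
        using W(1) S(1) unfolding cylinders_def by blast
      show "S \<inter> cylinder m p (P i) = \<Union> ((\<lambda>U. S \<inter> cylinder m p U) ` \<W>)"
        using cylinder_UN[of m p id \<W>] by (simp add: W(3))
      have "U = U'" if U: "U \<in> \<W>" "U' \<in> \<W>" and "a \<in> cylinder m p U" "b \<in> cylinder m p U'"
        and ab: "(a, b) \<in> word_entourage k" for U U' a b
      proof -
        obtain v w where vw: "a = p @ v" "b = p @ w" "v \<in> W" "w \<in> W"
          "first_letter x\<^sub>0 v \<in> U" "first_letter x\<^sub>0 w \<in> U'"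
          using \<open>a \<in> cylinder m p U\<close> \<open>b \<in> cylinder m p U'\<close> unfolding cylinder_def by blast
        have le: "free_dist x\<^sub>0 E v w \<le> enat l"
          using ab by (simp add: vw word_entourage_def free_entourage_def kE free_dist_append)
        have "entourage_dist E (first_letter x\<^sub>0 v) (first_letter x\<^sub>0 w) \<le> enat l"
        proof (cases "first_letter x\<^sub>0 v = first_letter x\<^sub>0 w")
          case True
          then show ?thesis
            using entourage_dist_refl[OF kE(3) first_letter_in[OF vw(4)]] by simp
        next
          case False
          then show ?thesis
            using le unfolding free_dist_first_letter[OF False] add.assoc
            by (meson add_increasing2 order_trans order_refl zero_le)
        qed
        then have "(first_letter x\<^sub>0 v, first_letter x\<^sub>0 w) \<in> base_entourage k"
          using first_letter_in vw by (simp add: base_entourage_def kE)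
        then show ?thesis using W(2) U vw unfolding entourage_disjoint_def by blast
      qed
      then show "entourage_disjoint (word_entourage k) ((\<lambda>U. S \<inter> cylinder m p U) ` \<W>)"
        unfolding entourage_disjoint_def by blast
    qed
  qed
qed

text \<open>The step that shortens words. \<open>\<B>\<close> may depend on the scale
  \<open>k\<close>, but its bound is uniform in the prefix \<open>p\<close> and in
  \<open>Y\<close>.\<close>

lemma decomposable_over_cylinders_bounded:
  assumes k: "k \<in> scales" and bdd: "bounded_family \<E> \<Y>"
  obtains \<B> where "\<B> \<subseteq> Pow W" "bounded_family \<F> \<B>"
    "decomposable_over (word_entourage k) 2 (cylinders (Suc m) \<Y>) (cylinders m {X} \<union> \<B>)"
proof -
  obtain E l where kE: "k = (E, l)" "E \<in> \<E>" "Id_on X \<subseteq> E" "E\<inverse> = E"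
    using k by (auto simp: scales_def)
  let ?near = "\<lambda>p Y. {p @ v |v. v \<in> W \<and> first_letter x\<^sub>0 v \<in> Y \<and> norm_from x\<^sub>0 E (tl v) \<le> enat l}"
  define \<B> where "\<B> = {S. \<exists>p\<in>W. \<exists>Y\<in>\<Y>. S \<subseteq> ?near p Y}"
  show thesis
  proof (rule that[of \<B>])
    show "\<B> \<subseteq> Pow W" by (auto simp: \<B>_def free_words_append)
    obtain K where K: "K \<in> \<E>" "(\<Union>U\<in>\<Y>. U \<times> U) \<subseteq> K" using bdd by (auto simp: bounded_family_def)
    \<comment> \<open>\<open>H\<close> contains \<open>E\<close>, so norms bounded for
      \<open>E\<close> stay bounded, and \<open>K\<close>, so first letters from one member of
      \<open>\<Y>\<close> are related.\<close>
    obtain H where H: "H \<in> \<E>" "E \<union> K \<subseteq> H" "Id_on X \<subseteq> H" "H\<inverse> = H"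
      using entourage_symmetric_hull[OF union[OF kE(2) K(1)]] .
    have "(p @ v, p @ w) \<in> free_entourage X x\<^sub>0 H (1 + 2 * l)"
      if "p \<in> W" "Y \<in> \<Y>" "v \<in> W" "w \<in> W" "first_letter x\<^sub>0 v \<in> Y" "first_letter x\<^sub>0 w \<in> Y"
        "norm_from x\<^sub>0 E (tl v) \<le> enat l" "norm_from x\<^sub>0 E (tl w) \<le> enat l" for p Y v w
    proof -
      have "norm_from x\<^sub>0 H u \<le> norm_from x\<^sub>0 E u" for u using H(2) by (intro norm_from_antimono) auto
      then have "free_dist x\<^sub>0 H v w \<le> enat (1 + 2 * l)"
        using that K(2) H(2)
        by (intro free_dist_le_first_letter[OF H(3) entourage_subset[OF H(1)] H(4)])
          (auto intro: order_trans)
      then show ?thesis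
        using that by (simp add: free_entourage_def free_dist_append free_words_append)
    qed
    then have "(\<Union>U\<in>\<B>. U \<times> U) \<subseteq> free_entourage X x\<^sub>0 H (1 + 2 * l)"
      unfolding \<B>_def by blast
    moreover have "free_entourage X x\<^sub>0 H (1 + 2 * l) \<in> \<F>"
      using H(1) by (auto simp: free_coarse_structure_def)
    ultimately show "bounded_family \<F> \<B>" unfolding bounded_family_def by blast
    show "decomposable_over (word_entourage k) 2 (cylinders (Suc m) \<Y>) (cylinders m {X} \<union> \<B>)"
    proof (rule decomposable_over_twoI)
      fix S assume "S \<in> cylinders (Suc m) \<Y>"
      then obtain p Y where S: "p \<in> W" "Y \<in> \<Y>" "S \<subseteq> cylinder (Suc m) p Y"
        by (auto simp: cylinders_def)
      \<comment> \<open>The negated inequality includes words \<open>c\<close> of infinite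
        norm.\<close>
      define far where "far b = {p @ b # c |c. p @ b # c \<in> S \<and> b # c \<in> W \<and> length c \<le> m \<and>
        \<not> norm_from x\<^sub>0 E c \<le> enat l}" for b
      have "far b \<in> cylinders m {X}" if "b \<in> X - {x\<^sub>0}" for b
      proof -
        \<comment> \<open>Moving \<open>b\<close> into the prefix leaves at most \<open>m\<close>
          letters, with no condition on the first of them.\<close>
        have "far b \<subseteq> cylinder m (p @ [b]) X"
          using first_letter_in by (auto simp: far_def cylinder_def free_words_def)
        moreover have "p @ [b] \<in> W" using S(1) that by (auto simp: free_words_def)
        ultimately show ?thesis by (auto simp: cylinders_def)
      qed
      moreover have "entourage_disjoint (word_entourage k) (far ` (X - {x\<^sub>0}))"
      proof -
        have "b = b'" if u: "u \<in> far b" "u' \<in> far b'" "(u, u') \<in> word_entourage k" for b b' u u'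
        proof (rule ccontr)
          assume "b \<noteq> b'"
          moreover obtain c c' where c: "u = p @ b # c" "u' = p @ b' # c'"
            "\<not> norm_from x\<^sub>0 E c \<le> enat l"
            using u unfolding far_def by blast
          ultimately have "entourage_dist E b b' + norm_from x\<^sub>0 E c + norm_to x\<^sub>0 E c' \<le> enat l"
            using u(3)
            by (simp add: word_entourage_def free_entourage_def kE free_dist_append free_dist_Cons)
          then have "norm_from x\<^sub>0 E c \<le> enat l"
            by (meson add_increasing add_increasing2 order_trans order_refl zero_le)
          then show False using c(3) by simp
        qed
        then show ?thesis unfolding entourage_disjoint_def by blast
      qed
      moreover have "S \<inter> ?near p Y \<in> \<B>" using S(1,2) by (auto simp: \<B>_def)
      moreover have "S = \<Union>{S \<inter> ?near p Y} \<union> \<Union>(far ` (X - {x\<^sub>0}))"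
      proof
        show "S \<subseteq> \<Union>{S \<inter> ?near p Y} \<union> \<Union>(far ` (X - {x\<^sub>0}))"
        proof
          fix u assume u: "u \<in> S"
          then obtain v where v: "u = p @ v" "v \<in> W" "length v \<le> Suc m" "first_letter x\<^sub>0 v \<in> Y"
            using S(3) by (auto simp: cylinder_def)
          show "u \<in> \<Union>{S \<inter> ?near p Y} \<union> \<Union>(far ` (X - {x\<^sub>0}))"
          proof (cases "norm_from x\<^sub>0 E (tl v) \<le> enat l")
            case True
            then show ?thesis using u v by blast
          next
            case False
            \<comment> \<open>For empty \<open>v\<close> the tail has norm 0 and the previous case
              applies.\<close>
            then obtain b c where "v = b # c"
              by (cases v) (auto simp: norm_from_def zero_enat_def[symmetric])
            then have "u \<in> far b" "b \<in> X - {x\<^sub>0}"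
              using False u v by (auto simp: far_def free_words_def)
            then show ?thesis by blast
          qed
        qed
      qed (auto simp: far_def)
      ultimately show "\<exists>\<W> \<W>'. \<W> \<subseteq> cylinders m {X} \<union> \<B> \<and> \<W>' \<subseteq> cylinders m {X} \<union> \<B> \<and>
          entourage_disjoint (word_entourage k) \<W> \<and> entourage_disjoint (word_entourage k) \<W>' \<and>
          S = \<Union>\<W> \<union> \<Union>\<W>'"
        by (intro exI[of _ "{S \<inter> ?near p Y}"] exI[of _ "far ` (X - {x\<^sub>0})"])
          (auto simp: entourage_disjoint_def)
    qed
  qed
qed

text \<open>Annulus \<open>j\<close> holds the lengths from \<open>j * R\<close> to below
  \<open>(j + 1) * R\<close>, and the parity of \<open>j\<close> gives the two families. Within an
  annulus, words are sorted by their prefix of length \<open>(j - 1) * R\<close>, which leaves fewer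
  than \<open>2 * R\<close> letters.\<close>

lemma decomposable_over_annuli:
  assumes k: "k \<in> scales"
  shows "decomposable_over (word_entourage k) 2 {W} (cylinders (2 * (snd k + 2)) {X})"
proof (rule decomposable_over_twoI)
  obtain E n where kE: "k = (E, n)" "E\<inverse> = E" using k by (auto simp: scales_def)
  \<comment> \<open>\<open>R\<close> exceeds \<open>n + 1\<close>, which bounds both the difference
    in length of close words and the ends on which they may disagree.\<close>
  define R where "R = n + 2"
  have R: "R > 0" by (simp add: R_def)
  \<comment> \<open>For \<open>j = 0\<close>, truncated subtraction makes the prefix \<open>p\<close> empty.\<close>
  define ann where "ann j p = {w \<in> W. length w div R = j \<and> take ((j - 1) * R) w = p}" for j p
  define \<W> where "\<W> I = {ann j p |j p. j \<in> I \<and> p \<in> W}" for I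
  have lengths: "(j - 1) * R \<le> length w" "length w - (j - 1) * R \<le> 2 * R"
    "j = 0 \<or> (j - 1) * R + Suc n \<le> length w"
    if "length w div R = j" for w :: "'a list" and j
  proof -
    have "j * R \<le> length w" "length w < j * R + R"
      using that div_times_less_eq_dividend[of "length w" R] dividend_less_div_times[OF R, of "length w"]
      by simp_all
    then show "(j - 1) * R \<le> length w" "length w - (j - 1) * R \<le> 2 * R"
      "j = 0 \<or> (j - 1) * R + Suc n \<le> length w"
      by (cases j; simp add: R_def)+
  qed
  have take_in: "take r w \<in> W" "drop r w \<in> W" if "w \<in> W" for r w
    using that by (auto simp: free_words_def dest: in_set_takeD in_set_dropD)
  have "ann j p \<in> cylinders (2 * R) {X}" if "p \<in> W" for j p
  proof -
    have "ann j p \<subseteq> cylinder (2 * R) p X"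
    proof
      fix w assume "w \<in> ann j p"
      then have w: "w \<in> W" "length w div R = j" "take ((j - 1) * R) w = p" by (auto simp: ann_def)
      then have "w = p @ drop ((j - 1) * R) w" by (metis append_take_drop_id)
      then show "w \<in> cylinder (2 * R) p X"
        using lengths[OF w(2)] take_in[OF w(1)] first_letter_in
        unfolding cylinder_def by (intro CollectI exI[of _ "drop ((j - 1) * R) w"]) auto
    qed
    then show ?thesis using that by (auto simp: cylinders_def)
  qed
  then have sub: "\<W> I \<subseteq> cylinders (2 * (snd k + 2)) {X}" for I by (auto simp: \<W>_def R_def kE)
  have close: "j = j' \<and> p = p'" if "u \<in> ann j p" "u' \<in> ann j' p'" "(u, u') \<in> word_entourage k"
    "even j \<longleftrightarrow> even j'" for u u' j j' p p'
  proof -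
    have u: "u \<in> W" "u' \<in> W" "length u div R = j" "length u' div R = j'"
      "take ((j - 1) * R) u = p" "take ((j' - 1) * R) u' = p'"
      using that by (auto simp: ann_def)
    have cp: "length u \<le> length u' + Suc n" "length u' \<le> length u + Suc n"
      "\<And>r. r + Suc n \<le> length u \<Longrightarrow> r + Suc n \<le> length u' \<Longrightarrow> take r u = take r u'"
      using free_dist_common_prefix[OF kE(2), of x\<^sub>0 u u' n] u(1,2) that(3)
      by (auto simp: word_entourage_def free_entourage_def kE free_words_def)
    have "length u \<le> length u' + R" "length u' \<le> length u + R" using cp by (auto simp: R_def)
    then have "j \<le> Suc j'" "j' \<le> Suc j"
      using div_le_mono[of "length u" "length u' + R" R] div_le_mono[of "length u'" "length u + R" R]
        u R by auto
    \<comment> \<open>Close words lie in equal or adjacent annuli, and adjacent indices have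
      different parity.\<close>
    then have "j = j'" using that(4) by (metis even_Suc le_SucE le_antisym)
    then show ?thesis
      using cp(3)[of "(j - 1) * R"] lengths(3)[OF u(3)] lengths(3)[of u' j] u by auto
  qed
  have disj: "entourage_disjoint (word_entourage k) (\<W> I)" if "I = Collect even \<or> I = Collect odd" for I
  proof -
    have "U = U'" if "U \<in> \<W> I" "U' \<in> \<W> I" "u \<in> U" "u' \<in> U'" "(u, u') \<in> word_entourage k" for U U' u u'
      using that \<open>I = _ \<or> _\<close> close unfolding \<W>_def by blast
    then show ?thesis unfolding entourage_disjoint_def by blast
  qed
  have "W = \<Union>(\<W> (Collect even)) \<union> \<Union>(\<W> (Collect odd))"
  proof
    show "W \<subseteq> \<Union>(\<W> (Collect even)) \<union> \<Union>(\<W> (Collect odd))"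
    proof
      fix w assume w: "w \<in> W"
      define j where "j = length w div R"
      have "w \<in> ann j (take ((j - 1) * R) w)" using w by (simp add: ann_def j_def)
      moreover have "ann j (take ((j - 1) * R) w) \<in> \<W> I" if "j \<in> I" for I
        using that take_in(1)[OF w] by (auto simp: \<W>_def)
      ultimately show "w \<in> \<Union>(\<W> (Collect even)) \<union> \<Union>(\<W> (Collect odd))"
        by (cases "even j") (metis UnI1 UnI2 UnionI mem_Collect_eq)+
    qed
  qed (auto simp: \<W>_def ann_def)
  then show "\<exists>\<W> \<W>'. \<W> \<subseteq> cylinders (2 * (snd k + 2)) {X} \<and> \<W>' \<subseteq> cylinders (2 * (snd k + 2)) {X} \<and>
      entourage_disjoint (word_entourage k) \<W> \<and> entourage_disjoint (word_entourage k) \<W>' \<and>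
      Y = \<Union>\<W> \<union> \<Union>\<W>'" if "Y \<in> {W}" for Y
    using sub disj that
    by (intro exI[of _ "\<W> (Collect even)"] exI[of _ "\<W> (Collect odd)"]) simp
qed


section \<open>Transfer to the free product\<close>

text \<open>\<open>P\<close> is an invariant of states under which only members of
  \<open>scales\<close> are played. \<open>2 \<in> N\<close> permits the moves that cut into annuli
  or split off far words; \<open>pos\<close> lets bounded families be carried along.\<close>

context
  fixes N :: "nat set" and nxt :: "'s \<Rightarrow> ((('a \<times> 'a) set \<times> nat) \<times> 's) set" and P :: "'s \<Rightarrow> bool"
  assumes two: "2 \<in> N" and pos: "\<forall>n\<in>N. 1 \<le> n"
    and nxt: "\<And>s k t. P s \<Longrightarrow> (k, t) \<in> nxt s \<Longrightarrow> k \<in> scales \<and> P t"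
begin

text \<open>The strategy on \<open>X\<close> is copied move by move. Once it reaches a bounded
  family, one further move with two pieces leads to shorter words. The state at that point is not
  known in advance, so the last assumption covers all states with \<open>P\<close>.\<close>

lemma decomposition_game_cylinders_Suc:
  assumes "decomposition_game X \<E> base_entourage N nxt s \<Y>" "P s"
    and "\<And>s. P s \<Longrightarrow> decomposition_game W \<F> word_entourage N nxt s (cylinders m {X})"
  shows "decomposition_game W \<F> word_entourage N nxt s (cylinders (Suc m) \<Y>)"
  using assms(1,2)
proof (induction rule: decomposition_game.induct)
  case (bounded \<Y> s)
  show ?case
  proof (rule decomposition_game.decompose[OF cylinders_subset_Pow two], intro allI impI)
    fix k t assume "(k, t) \<in> nxt s"
    then have kt: "k \<in> scales" "P t" using nxt bounded by auto
    obtain \<B> where "\<B> \<subseteq> Pow W" "bounded_family \<F> \<B>"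
      "decomposable_over (word_entourage k) 2 (cylinders (Suc m) \<Y>) (cylinders m {X} \<union> \<B>)"
      using decomposable_over_cylinders_bounded[OF kt(1) bounded(2)] .
    then show "\<exists>\<Z>. decomposition_game W \<F> word_entourage N nxt t \<Z> \<and>
        decomposable_over (word_entourage k) 2 (cylinders (Suc m) \<Y>) \<Z>"
      using free.decomposition_game_Un_bounded[OF assms(3)[OF kt(2)] pos] by blast
  qed
next
  case (decompose \<Y> n s)
  show ?case
  proof (rule decomposition_game.decompose[OF cylinders_subset_Pow \<open>n \<in> N\<close>], intro allI impI)
    fix k t assume kt: "(k, t) \<in> nxt s"
    then have "k \<in> scales" "P t" using nxt decompose.prems by auto
    then show "\<exists>\<Z>. decomposition_game W \<F> word_entourage N nxt t \<Z> \<and>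
        decomposable_over (word_entourage k) n (cylinders (Suc m) \<Y>) \<Z>"
      using decompose.IH kt decomposable_over_cylinders by blast
  qed
qed

text \<open>The first scale played fixes the word length \<open>m\<close>; after that the game on
  \<open>X\<close> is played anew for each of the \<open>m\<close> letters. Each round begins in
  whatever state the previous one left, so \<open>X\<close> must be won from every state with
  \<open>P\<close>.\<close>

lemma decomposition_game_free_product:
  assumes X: "\<And>s. P s \<Longrightarrow> decomposition_game X \<E> base_entourage N nxt s {X}" and "P s"
  shows "decomposition_game W \<F> word_entourage N nxt s {W}"
proof (rule decomposition_game.decompose[OF _ two], simp, intro allI impI)
  have cyl: "decomposition_game W \<F> word_entourage N nxt s (cylinders m {X})" if "P s" for m s
    using that
  proof (induction m arbitrary: s)
    case 0
    show ?case by (intro decomposition_game.bounded cylinders_subset_Pow bounded_cylinders_zero)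
  next
    case (Suc m)
    then show ?case using decomposition_game_cylinders_Suc[OF X] by blast
  qed
  fix k t assume "(k, t) \<in> nxt s"
  then show "\<exists>\<Z>. decomposition_game W \<F> word_entourage N nxt t \<Z> \<and>
      decomposable_over (word_entourage k) 2 {W} \<Z>"
    using nxt[OF \<open>P s\<close>] cyl decomposable_over_annuli by blast
qed

end

section \<open>The three properties as instances of the game\<close>

definition any_scale :: "unit \<Rightarrow> ((('a \<times> 'a) set \<times> nat) \<times> unit) set" where
  "any_scale s = scales \<times> UNIV"

definition head_scale ::
    "(nat \<Rightarrow> ('a \<times> 'a) set \<times> nat) \<Rightarrow> ((('a \<times> 'a) set \<times> nat) \<times> (nat \<Rightarrow> ('a \<times> 'a) set \<times> nat)) set"
  where "head_scale s = {(s 0, s \<circ> Suc)}"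

lemma fcdc_imp_game:
  assumes "\<Y> \<in> fcdc_families X \<E>"
  shows "decomposition_game X \<E> base_entourage {2} any_scale () \<Y>"
  using assms
proof (induction rule: fcdc_families.induct)
  case (decompose \<Y>)
  then show ?case
    by (intro decomposition_game.decompose[where n = 2])
      (auto simp: any_scale_def dest!: base_entourage_in)
qed (rule decomposition_game.bounded)

lemma fwcdc_imp_game:
  assumes "\<Y> \<in> fwcdc_families X \<E>"
  shows "decomposition_game X \<E> base_entourage {1..} any_scale () \<Y>"
  using assms
proof (induction rule: fwcdc_families.induct)
  case (decompose \<Y> n)
  then show ?case
    by (intro decomposition_game.decompose[where n = n])
      (auto simp: any_scale_def dest!: base_entourage_in)
qed (rule decomposition_game.bounded)

text \<open>Scales are cofinal and disjointness passes to smaller entourages. \<open>Q\<close>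
  stands for membership in either inductively defined class.\<close>

lemma game_imp_decomposable:
  assumes "\<forall>k t. (k, t) \<in> any_scale s \<longrightarrow>
      (\<exists>\<Z>. Q \<Z> \<and> decomposable_over (word_entourage k) n \<Y> \<Z>)"
  shows "\<forall>L\<in>\<F>. \<exists>\<Z>. Q \<Z> \<and> decomposable_over L n \<Y> \<Z>"
proof
  fix L assume "L \<in> \<F>"
  then obtain k where "k \<in> scales" "L \<subseteq> word_entourage k" using free_entourage_cofinal by blast
  then show "\<exists>\<Z>. Q \<Z> \<and> decomposable_over L n \<Y> \<Z>"
    using assms decomposable_over_antimono unfolding any_scale_def by blast
qed

lemma game_imp_fcdc:
  assumes "decomposition_game W \<F> word_entourage {2} any_scale s \<Y>"
  shows "\<Y> \<in> fcdc_families W \<F>"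
  using assms
proof (induction rule: decomposition_game.induct)
  case (decompose \<Y> n s)
  then have "\<forall>L\<in>\<F>. \<exists>\<Z>. \<Z> \<in> fcdc_families W \<F> \<and> decomposable_over L n \<Y> \<Z>"
    by (intro game_imp_decomposable[of s]) blast
  then show ?case using decompose.hyps by (intro fcdc_families.decompose) auto
qed (rule fcdc_families.bounded)

lemma game_imp_fwcdc:
  assumes "decomposition_game W \<F> word_entourage {1..} any_scale s \<Y>"
  shows "\<Y> \<in> fwcdc_families W \<F>"
  using assms
proof (induction rule: decomposition_game.induct)
  case (decompose \<Y> n s)
  then have "\<forall>L\<in>\<F>. \<exists>\<Z>. \<Z> \<in> fwcdc_families W \<F> \<and> decomposable_over L n \<Y> \<Z>"
    by (intro game_imp_decomposable[of s]) blast
  then show ?case using decompose.hyps by (intro fwcdc_families.decompose) auto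
qed (rule fwcdc_families.bounded)

text \<open>Straightness speaks of increasing sequences, while scales may come in any order; finite
  unions make them increasing. The chain obtained for the unions is then read backwards from its
  bounded end.\<close>

lemma straight_imp_game:
  assumes "straight_finite_dc X \<E>" "\<forall>i. s i \<in> scales"
  shows "decomposition_game X \<E> base_entourage {2} head_scale s {X}"
proof -
  define L where "L i = (\<Union>j\<le>i. base_entourage (s j))" for i
  have L: "base_entourage (s j) \<subseteq> L i" if "j \<le> i" for i j
    using that unfolding L_def by blast
  have "L i \<in> \<E>" for i
  proof (induction i)
    case (Suc i)
    have "L (Suc i) = base_entourage (s (Suc i)) \<union> L i" by (simp add: L_def atMost_Suc)
    then show ?case using Suc base_entourage_in assms(2) union by metis
  qed (use base_entourage_in assms(2) in \<open>simp add: L_def\<close>)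
  moreover have "L i \<subseteq> L (i + 1)" for i unfolding L_def by (intro UN_mono) auto
  ultimately obtain n \<V> where V: "\<V> 0 = {X}" "\<forall>i\<le>n. \<V> i \<subseteq> Pow X"
    "\<forall>i\<in>{1..n}. decomposable_over (L i) 2 (\<V> (i - 1)) (\<V> i)" "bounded_family \<E> (\<V> n)"
    using assms(1)[unfolded straight_finite_dc_def, rule_format, of L] by blast
  \<comment> \<open>After \<open>i\<close> moves the remaining sequence is \<open>s\<close> shifted
    by \<open>i\<close>.\<close>
  have "decomposition_game X \<E> base_entourage {2} head_scale (\<lambda>j. s (i + j)) (\<V> i)" if "i \<le> n" for i
    using that
  proof (induction rule: inc_induct)
    case base
    then show ?case using V by (intro decomposition_game.bounded) auto
  next
    case (step i)
    \<comment> \<open>Game sequences start at 0 but entourages at 1, so move \<open>i\<close> is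
      answered by the decomposition for \<open>L (Suc i)\<close>.\<close>
    have "base_entourage (s i) \<subseteq> L (Suc i)" by (rule L) simp
    then have "decomposable_over (base_entourage (s i)) 2 (\<V> i) (\<V> (Suc i))"
      using V(3)[rule_format, of "Suc i"] step.hyps decomposable_over_antimono by auto
    moreover have "(\<lambda>j. s (i + j)) \<circ> Suc = (\<lambda>j. s (Suc i + j))" by auto
    ultimately show ?case
      using step V(2) by (intro decomposition_game.decompose[where n = 2]) (auto simp: head_scale_def)
  qed
  from this[of 0] show ?thesis by (simp add: V(1))
qed

text \<open>With \<open>head_scale\<close> each state admits a single move, so a winning strategy is
  a finite chain of families.\<close>

lemma game_imp_straight:
  assumes "decomposition_game W \<F> word_entourage {2} head_scale s \<Y>"
  shows "\<exists>n \<V>. \<V> 0 = \<Y> \<and> (\<forall>i\<le>n. \<V> i \<subseteq> Pow W) \<and>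
    (\<forall>i<n. decomposable_over (word_entourage (s i)) 2 (\<V> i) (\<V> (Suc i))) \<and>
    bounded_family \<F> (\<V> n)"
  using assms
proof (induction rule: decomposition_game.induct)
  case (bounded \<Y> s)
  then show ?case by (intro exI[of _ 0] exI[of _ "\<lambda>_. \<Y>"]) auto
next
  case (decompose \<Y> n s)
  then obtain \<Z> m \<V> where V: "\<V> 0 = \<Z>" "\<forall>i\<le>m. \<V> i \<subseteq> Pow W"
    "\<forall>i<m. decomposable_over (word_entourage (s (Suc i))) 2 (\<V> i) (\<V> (Suc i))"
    "bounded_family \<F> (\<V> m)" "decomposable_over (word_entourage (s 0)) 2 \<Y> \<Z>"
    by (auto simp: head_scale_def)
  show ?case
    \<comment> \<open>\<open>case_nat\<close> puts \<open>\<Y>\<close> in front of the chain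
      obtained for the shifted sequence.\<close>
    by (intro exI[of _ "Suc m"] exI[of _ "case_nat \<Y> \<V>"])
      (use V decompose.hyps(1) in \<open>auto split: nat.split simp: less_Suc_eq_0_disj\<close>)
qed

section \<open>Each property for the free product\<close>

lemma finite_coarse_dc_free_product:
  assumes "finite_coarse_dc X \<E>" shows "finite_coarse_dc W \<F>"
proof -
  have X: "decomposition_game X \<E> base_entourage {2} any_scale s {X}" for s
    using fcdc_imp_game assms unfolding finite_coarse_dc_def by simp
  have "decomposition_game W \<F> word_entourage {2} any_scale () {W}"
    by (rule decomposition_game_free_product[where P = "\<lambda>_. True", OF _ _ _ X])
      (auto simp: any_scale_def)
  then show ?thesis unfolding finite_coarse_dc_def by (rule game_imp_fcdc)
qed

lemma finite_weak_coarse_dc_free_product: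
  assumes "finite_weak_coarse_dc X \<E>" shows "finite_weak_coarse_dc W \<F>"
proof -
  have X: "decomposition_game X \<E> base_entourage {1..} any_scale s {X}" for s
    using fwcdc_imp_game assms unfolding finite_weak_coarse_dc_def by simp
  have "decomposition_game W \<F> word_entourage {1..} any_scale () {W}"
    by (rule decomposition_game_free_product[where P = "\<lambda>_. True", OF _ _ _ X])
      (auto simp: any_scale_def)
  then show ?thesis unfolding finite_weak_coarse_dc_def by (rule game_imp_fwcdc)
qed

lemma straight_finite_dc_free_product:
  assumes "straight_finite_dc X \<E>" shows "straight_finite_dc W \<F>"
  unfolding straight_finite_dc_def
proof (intro allI impI)
  fix L :: "nat \<Rightarrow> _" assume L: "\<forall>i\<ge>1. L i \<in> \<F> \<and> L i \<subseteq> L (i + 1)"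
  then have "\<forall>i. \<exists>k\<in>scales. L (Suc i) \<subseteq> word_entourage k" using free_entourage_cofinal by simp
  then obtain s where s: "\<forall>i. s i \<in> scales" "\<And>i. L (Suc i) \<subseteq> word_entourage (s i)" by metis
  \<comment> \<open>The invariant, that all entries are scales, survives dropping the head of the
    sequence.\<close>
  have "decomposition_game W \<F> word_entourage {2} head_scale s {W}"
    by (rule decomposition_game_free_product[where P = "\<lambda>s. \<forall>i. s i \<in> scales"])
      (use s(1) straight_imp_game[OF assms] in \<open>auto simp: head_scale_def\<close>)
  then obtain n \<V> where V: "\<V> 0 = {W}" "\<forall>i\<le>n. \<V> i \<subseteq> Pow W"
    "\<forall>i<n. decomposable_over (word_entourage (s i)) 2 (\<V> i) (\<V> (Suc i))" "bounded_family \<F> (\<V> n)"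
    using game_imp_straight[of s "{W}"] by auto
  have "decomposable_over (L i) 2 (\<V> (i - 1)) (\<V> i)" if "i \<in> {1..n}" for i
    using that V(3) decomposable_over_antimono[OF s(2)] by (cases i) auto
  then show "\<exists>n \<V>. \<V> 0 = {W} \<and> (\<forall>i\<le>n. \<V> i \<subseteq> Pow W) \<and>
      (\<forall>i\<in>{1..n}. decomposable_over (L i) 2 (\<V> (i - 1)) (\<V> i)) \<and> bounded_family \<F> (\<V> n)"
    using V by blast
qed

end

theorem corollary4p7:
  fixes X :: "'a set" and \<E> :: "('a \<times> 'a) set set" and x\<^sub>0 :: 'a
  assumes "coarse_space X \<E>"
    and "x\<^sub>0 \<in> X"
  shows "(finite_weak_coarse_dc X \<E> \<longrightarrow>
            finite_weak_coarse_dc (free_words X x\<^sub>0) (free_coarse_structure X \<E> x\<^sub>0)) \<and>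
         (finite_coarse_dc X \<E> \<longrightarrow>
            finite_coarse_dc (free_words X x\<^sub>0) (free_coarse_structure X \<E> x\<^sub>0)) \<and>
         (straight_finite_dc X \<E> \<longrightarrow>
            straight_finite_dc (free_words X x\<^sub>0) (free_coarse_structure X \<E> x\<^sub>0))"
proof -
  interpret pointed_coarse_space X \<E> x\<^sub>0
    using assms by (simp add: pointed_coarse_space_def pointed_coarse_space_axioms_def)
  show ?thesis
    using finite_weak_coarse_dc_free_product finite_coarse_dc_free_product
      straight_finite_dc_free_product by blast
qed

end
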